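(* Let $X$ be the geometric realization of the graph with vertex set $V=\{a,b,c,d,e\}$ and edge set $E=\{ab,ac,ad,ae,bc,bd,be,cd,ce\}$ (the $1$-skeleton of a triangular bipyramid), and let $f:X\to[0,\infty)$ be the function that is linear on each edge with vertex values $f(d)=f(e)=3$ and $f(a)=f(b)=f(c)=1$. Then the unimodal category of $f$ is $\mathbf{ucat}(f)=3$.
   Context: A continuous function $u:X\to[0,\infty)$ on a topological space is unimodal if there is $M>0$ such that the superlevel set $u^{-1}[c,\infty)$ is contractible for $0<c\le M$ and empty for $c>M$. The unimodal category $\mathbf{ucat}(f)$ of $f:X\to[0,\infty)$ is the minimum number $n$ of unimodal functions $u_1,\dots,u_n:X\to[0,\infty)$ such that pointwise $f=\sum_{i=1}^n u_i$. Here $xy$ is shorthand for the edge $\{x,y\}$. *)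

theory Defs
  imports "HOL-Analysis.Analysis" "HOL-Library.Extended_Nat"
begin

text \<open>The library predicate \<open>contractible_space\<close> also holds of the empty space, whereas here
  contractible means homotopy equivalent to a point; hence the extra nonemptiness conjunct.\<close>

definition unimodal :: "'a topology \<Rightarrow> ('a \<Rightarrow> real) \<Rightarrow> bool" where
  "unimodal X u \<longleftrightarrow>
     continuous_map X euclideanreal u \<and> (\<forall>x\<in>topspace X. 0 \<le> u x) \<and>
     (\<exists>M>0. \<forall>c.
        (0 < c \<and> c \<le> M \<longrightarrow>
           {x \<in> topspace X. c \<le> u x} \<noteq> {} \<and>
           contractible_space (subtopology X {x \<in> topspace X. c \<le> u x})) \<and>
        (M < c \<longrightarrow> {x \<in> topspace X. c \<le> u x} = {}))"

text \<open>The infimum is taken in \<open>enat\<close>, so it is a minimum whenever a decomposition exists and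
  is \<open>\<infinity>\<close> otherwise.\<close>

definition ucat :: "'a topology \<Rightarrow> ('a \<Rightarrow> real) \<Rightarrow> enat" where
  "ucat X f =
     Inf {enat n | n. \<exists>u :: nat \<Rightarrow> 'a \<Rightarrow> real.
            (\<forall>i<n. unimodal X (u i)) \<and> (\<forall>x\<in>topspace X. f x = (\<Sum>i<n. u i x))}"

text \<open>A finite graph is realized inside the standard simplex: the vertex \<open>v\<close> is the basis vector
  \<open>vertex_point v\<close>, and an edge is the segment joining its two endpoints. As the basis vectors are
  affinely independent, distinct edges meet at most in a common endpoint.\<close>

definition vertex_point :: "'v::finite \<Rightarrow> real ^ 'v" where
  "vertex_point v = axis v 1"

definition graph_realization :: "'v::finite set \<Rightarrow> 'v set set \<Rightarrow> (real ^ 'v) set" where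
  "graph_realization V E =
     vertex_point ` V \<union> (\<Union>e\<in>E. convex hull (vertex_point ` e))"

definition linear_on_edges :: "'v::finite set set \<Rightarrow> (real ^ 'v \<Rightarrow> real) \<Rightarrow> bool" where
  "linear_on_edges E f \<longleftrightarrow>
     (\<forall>v w. {v, w} \<in> E \<longrightarrow> (\<forall>t\<in>{0..1}.
        f ((1 - t) *\<^sub>R vertex_point v + t *\<^sub>R vertex_point w) =
          (1 - t) * f (vertex_point v) + t * f (vertex_point w)))"

datatype vertex = Va | Vb | Vc | Vd | Ve

lemma UNIV_vertex: "UNIV = {Va, Vb, Vc, Vd, Ve}"
  using vertex.exhaust by blast

instance vertex :: finite
  by standard (simp add: UNIV_vertex)

definition bipyramid_vertices :: "vertex set" where
  "bipyramid_vertices = {Va, Vb, Vc, Vd, Ve}"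

definition bipyramid_edges :: "vertex set set" where
  "bipyramid_edges =
     {{Va, Vb}, {Va, Vc}, {Va, Vd}, {Va, Ve}, {Vb, Vc}, {Vb, Vd}, {Vb, Ve}, {Vc, Vd}, {Vc, Ve}}"

end

theory Submission imports Defs begin

text \<open>
  Write \<open>x\<^sub>i\<close> for the barycentric coordinate of a point \<open>x\<close> of the realization at the vertex \<open>i\<close>. A
  function that is linear on edges is a linear form in these coordinates, so
  \<open>f x = x\<^sub>a + x\<^sub>b + x\<^sub>c + 3 x\<^sub>d + 3 x\<^sub>e\<close> (\<open>linear_on_bipyramid_edges_eq_height\<close>).

  Three summands suffice, because \<open>f\<close> is the sum over \<open>p = a, b, c\<close> of \<open>x\<^sub>p + x\<^sub>d + x\<^sub>e\<close>. Such a
  summand is \<open>1\<close> on the path \<open>d p e\<close> and falls off linearly along the other edges that meet this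
  path, so its superlevel sets shrink to the path (\<open>unimodal_star\<close>).

  Two summands do not suffice. Suppose \<open>f = u + v\<close>. On the base triangle \<open>abc\<close> we have \<open>f = 1\<close>, so the
  part where \<open>u > 1\<close> avoids the triangle; a superlevel set of \<open>u\<close> at a level above \<open>1\<close>, being
  connected, therefore lies on one side of it, near \<open>d\<close> or near \<open>e\<close>. The same holds for \<open>v\<close>
  (\<open>not_above_one_on_both_sides\<close>). As \<open>u + v = 3\<close> at both apexes, one function, say \<open>u\<close>, exceeds \<open>1\<close>
  near \<open>d\<close> only, and \<open>v\<close> near \<open>e\<close> only. At each of \<open>a, b, c\<close> one of the two functions is positive,
  so one of them, say \<open>u\<close>, is positive at two base vertices \<open>p\<close> and \<open>q\<close>. On the edges \<open>dp\<close> and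
  \<open>dq\<close> outside the base we have \<open>v \<le> 1 < f\<close>, hence \<open>u > 0\<close>. If \<open>u\<close> vanished at an inner point
  \<open>z\<close> of \<open>pq\<close>, then \<open>v z = 1\<close>, and the connected set \<open>v \<ge> 1\<close> would contain \<open>z\<close> and \<open>e\<close>, thus also
  \<open>p\<close> or \<open>q\<close>, where \<open>u\<close> would vanish (\<open>base_edge_separates\<close>). So \<open>u\<close> is positive on the whole
  circle \<open>d p q\<close>, and by compactness the circle lies in one superlevel set of \<open>u\<close>. That is impossible
  for a contractible set, because the graph retracts onto each of its triangles
  (\<open>contractible_subset_of_graph_no_triangle\<close>).
\<close>

section \<open>Coordinates on a graph realization\<close>

lemma convex_hull_vertex_points:
  fixes A :: "'v::finite set"
  shows "convex hull (vertex_point ` A) =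
    {x. (\<forall>i. 0 \<le> x $ i) \<and> (\<Sum>i\<in>UNIV. x $ i) = 1 \<and> (\<forall>i. i \<notin> A \<longrightarrow> x $ i = 0)}"
    (is "_ = ?R")
proof
  have "vertex_point ` A \<subseteq> ?R"
    by (auto simp: vertex_point_def axis_def)
  moreover have "convex ?R"
    by (rule convexI)
      (auto simp: sum.distrib sum_distrib_left[symmetric])
  ultimately show "convex hull (vertex_point ` A) \<subseteq> ?R"
    by (rule hull_minimal)
next
  show "?R \<subseteq> convex hull (vertex_point ` A)"
  proof clarify
    fix x :: "real ^ 'v"
    assume x: "\<forall>i. 0 \<le> x $ i" "(\<Sum>i\<in>UNIV. x $ i) = 1" "\<forall>i. i \<notin> A \<longrightarrow> x $ i = 0"
    have "(\<Sum>i\<in>A. x $ i *\<^sub>R vertex_point i) \<in> convex hull (vertex_point ` A)"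
    proof (rule convex_sum)
      have "(\<Sum>i\<in>A. x $ i) = (\<Sum>i\<in>UNIV. x $ i)"
        by (rule sum.mono_neutral_left) (use x in auto)
      then show "(\<Sum>i\<in>A. x $ i) = 1" using x by simp
    qed (use x in \<open>auto intro: hull_inc\<close>)
    also have "(\<Sum>i\<in>A. x $ i *\<^sub>R vertex_point i) = x"
      using x(3) by (auto simp: vec_eq_iff vertex_point_def axis_def if_distrib cong: if_cong)
    finally show "x \<in> convex hull (vertex_point ` A)" .
  qed
qed

lemma mem_graph_realization:
  assumes "V \<subseteq> \<Union>E"
  shows "x \<in> graph_realization V E \<longleftrightarrow>
    (\<forall>i. 0 \<le> x $ i) \<and> (\<Sum>i\<in>UNIV. x $ i) = 1 \<and> (\<exists>e\<in>E. \<forall>i. i \<notin> e \<longrightarrow> x $ i = 0)"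
proof -
  have "vertex_point ` V \<subseteq> (\<Union>e\<in>E. convex hull (vertex_point ` e))"
    using assms by (auto intro!: hull_inc)
  then have "graph_realization V E = (\<Union>e\<in>E. convex hull (vertex_point ` e))"
    by (auto simp: graph_realization_def)
  then show ?thesis
    by (auto simp: convex_hull_vertex_points)
qed

section \<open>Contractible subsets of a graph contain no triangle\<close>

lemma affine_independent_vertex_points:
  fixes A :: "'v::finite set"
  shows "\<not> affine_dependent (vertex_point ` A)"
proof -
  have "vertex_point ` A \<subseteq> (Basis :: (real ^ 'v) set)"
    by (auto simp: vertex_point_def axis_in_Basis_iff)
  then show ?thesis
    using affine_dependent_imp_dependent independent_substdbasis by blast
qed

lemma inj_vertex_point: "inj vertex_point"
  by (auto simp: inj_on_def vertex_point_def axis_eq_axis)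

text \<open>Relative frontiers of bounded convex sets of equal affine dimension are homeomorphic, so the
  boundary of the triangle is a circle; the disc in the complex plane is the model.\<close>

lemma not_contractible_boundary_of_2_simplex:
  fixes C :: "'a::euclidean_space set"
  assumes "\<not> affine_dependent C" "card C = 3"
  shows "\<not> contractible (rel_frontier (convex hull C))"
proof -
  have "aff_dim C = 2"
    using aff_dim_affine_independent[OF assms(1)] assms(2) by simp
  moreover have "finite C"
    using assms(1) aff_independent_finite by blast
  ultimately have "rel_frontier (convex hull C) homeomorphic rel_frontier (cball (0::complex) 1)"
    by (intro homeomorphic_rel_frontiers_convex_bounded_sets)
      (auto simp: aff_dim_cball aff_dim_convex_hull finite_imp_bounded_convex_hull)
  then show ?thesis
    using contractible_sphere[of "0::complex" 1] homeomorphic_contractible_eq by fastforce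
qed

text \<open>Sending every vertex other than \<open>p\<close> and \<open>q\<close> to \<open>s\<close> is a simplicial map onto the triangle
  \<open>pqs\<close> that fixes the triangle. It restricts to a retraction of any subset of the
  graph containing the triangle, and retracts of contractible sets are contractible.\<close>

lemma contractible_subset_of_graph_no_triangle:
  fixes E :: "'v::finite set set"
  assumes E: "\<And>e. e \<in> E \<Longrightarrow> card e = 2" "V \<subseteq> \<Union>E"
    and S: "S \<subseteq> graph_realization V E" "contractible S"
    and neq: "p \<noteq> q" "q \<noteq> s" "s \<noteq> p"
    and sub: "\<And>i. i \<in> {p, q, s} \<Longrightarrow> convex hull (vertex_point ` ({p, q, s} - {i})) \<subseteq> S"
  shows False
proof -
  define C where "C = vertex_point ` {p, q, s}"
  define T where "T = rel_frontier (convex hull C)"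
  have indep: "\<not> affine_dependent C"
    unfolding C_def by (rule affine_independent_vertex_points)
  have "card C = 3"
    using neq by (simp add: C_def card_image[OF inj_on_subset[OF inj_vertex_point]] del: image_insert)
  have T_eq: "T = (\<Union>i\<in>{p, q, s}. convex hull (vertex_point ` ({p, q, s} - {i})))"
  proof -
    have "C - {vertex_point i} = vertex_point ` ({p, q, s} - {i})" for i
      by (auto simp: C_def inj_eq[OF inj_vertex_point])
    then show ?thesis
      unfolding T_def rel_frontier_convex_hull_cases[OF indep] by (auto simp: C_def)
  qed
  \<comment> \<open>The linear extension of the simplicial map: \<open>s\<close> collects all the weight outside \<open>p\<close> and \<open>q\<close>.\<close>
  define r :: "real ^ 'v \<Rightarrow> real ^ 'v" where
    "r x = (\<chi> i. if i = p \<or> i = q then x $ i else if i = s then 1 - x $ p - x $ q else 0)" for x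
  have r_sum: "(\<Sum>i\<in>UNIV. r x $ i) = 1" for x
  proof -
    have "(\<Sum>i\<in>UNIV. r x $ i) = (\<Sum>i\<in>{p, q, s}. r x $ i)"
      by (rule sum.mono_neutral_right) (auto simp: r_def)
    then show ?thesis using neq by (simp add: r_def)
  qed
  have two: "y $ p + y $ q \<le> 1" if "\<forall>i. 0 \<le> y $ i" "(\<Sum>i\<in>UNIV. y $ i) = 1" for y :: "real ^ 'v"
  proof -
    have "(\<Sum>i\<in>{p, q}. y $ i) \<le> (\<Sum>i\<in>UNIV. y $ i)"
      by (rule sum_mono2) (use that in auto)
    then show ?thesis using that neq by simp
  qed
  have "retraction S T r"
    unfolding retraction_def
  proof (intro conjI ballI)
    show "T \<subseteq> S" unfolding T_eq by (rule UN_least) (rule sub)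
    have "continuous_on S (\<lambda>x. if i = p \<or> i = q then x $ i else if i = s then 1 - x $ p - x $ q else 0)"
      for i
      by (cases "i = p \<or> i = q"; cases "i = s") (auto intro!: continuous_intros)
    then show "continuous_on S r"
      unfolding r_def by (rule continuous_on_vec_lambda)
    show "r \<in> S \<rightarrow> T"
    proof
      fix x assume "x \<in> S"
      then have x: "\<forall>i. 0 \<le> x $ i" "(\<Sum>i\<in>UNIV. x $ i) = 1"
        and "\<exists>e\<in>E. \<forall>i. i \<notin> e \<longrightarrow> x $ i = 0"
        using S(1) mem_graph_realization[OF E(2)] by auto
      then obtain e where e: "e \<in> E" "\<forall>i. i \<notin> e \<longrightarrow> x $ i = 0"
        by blast
      have nonneg: "\<forall>i. 0 \<le> r x $ i"
        using x two[OF x] by (auto simp: r_def)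
      have hull: "r x \<in> T" if "i \<in> {p, q, s}" "r x $ i = 0" for i
        using that nonneg r_sum[of x] unfolding T_eq convex_hull_vertex_points
        by (auto simp: r_def split: if_splits)
      \<comment> \<open>An edge that avoids \<open>p\<close> or \<open>q\<close> is collapsed into the opposite side; otherwise it is
        the side \<open>pq\<close> itself.\<close>
      show "r x \<in> T"
      proof (cases "p \<in> e \<and> q \<in> e")
        case True
        obtain v w where "e = {v, w}" using E(1)[OF e(1)] by (auto simp: card_2_iff)
        with True neq have "e = {p, q}" by auto
        have "(\<Sum>i\<in>UNIV. x $ i) = (\<Sum>i\<in>{p, q}. x $ i)"
          by (rule sum.mono_neutral_right) (use e \<open>e = {p, q}\<close> in auto)
        then have "r x $ s = 0" using x neq by (simp add: r_def)
        then show ?thesis by (intro hull[of s]) auto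
      next
        case False
        then have "r x $ p = 0 \<or> r x $ q = 0" using e by (auto simp: r_def)
        then show ?thesis using hull[of p] hull[of q] by auto
      qed
    qed
    fix x assume "x \<in> T"
    then have x: "(\<Sum>i\<in>UNIV. x $ i) = 1" "\<forall>i. i \<notin> {p, q, s} \<longrightarrow> x $ i = 0"
      unfolding T_eq convex_hull_vertex_points by auto
    have "(\<Sum>i\<in>UNIV. x $ i) = (\<Sum>i\<in>{p, q, s}. x $ i)"
      by (rule sum.mono_neutral_right) (use x in auto)
    then have "x $ s = 1 - x $ p - x $ q" using x neq by simp
    then show "r x = x" using x(2) by (auto simp: r_def vec_eq_iff)
  qed
  then have "contractible T"
    using S(2) retract_of_contractible by (auto simp: retract_of_def)
  then show False
    using not_contractible_boundary_of_2_simplex[OF indep \<open>card C = 3\<close>] by (simp add: T_def)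
qed

section \<open>The bipyramid graph\<close>

abbreviation bipyramid :: "(real ^ vertex) set" where
  "bipyramid \<equiv> graph_realization bipyramid_vertices bipyramid_edges"

lemma sum_vertex: "(\<Sum>i\<in>UNIV. g i) = g Va + g Vb + g Vc + g Vd + g Ve"
  for g :: "vertex \<Rightarrow> real"
  by (simp add: UNIV_vertex algebra_simps)

lemma bipyramid_vertices_covered: "bipyramid_vertices \<subseteq> \<Union>bipyramid_edges"
  by (auto simp: bipyramid_vertices_def bipyramid_edges_def)

lemma doubleton_in_bipyramid_edges:
  "{i, j} \<in> bipyramid_edges \<longleftrightarrow> i \<noteq> j \<and> (i \<in> {Va, Vb, Vc} \<or> j \<in> {Va, Vb, Vc})"
  by (cases i; cases j) (simp_all add: bipyramid_edges_def doubleton_eq_iff)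

lemma card_bipyramid_edge: "e \<in> bipyramid_edges \<Longrightarrow> card e = 2"
  by (auto simp: bipyramid_edges_def)

lemmas mem_bipyramid = mem_graph_realization[OF bipyramid_vertices_covered, unfolded sum_vertex]

lemma convex_hull_edge_subset_bipyramid:
  "e \<in> bipyramid_edges \<Longrightarrow> convex hull (vertex_point ` e) \<subseteq> bipyramid"
  by (auto simp: graph_realization_def)

lemma vertex_point_in_bipyramid: "vertex_point i \<in> bipyramid"
  by (cases i) (auto simp: graph_realization_def bipyramid_vertices_def)

lemma vertex_point_nth: "vertex_point i $ j = (if j = i then 1 else 0)"
  by (auto simp: vertex_point_def axis_def)

lemma all_vertex: "(\<forall>i. P i) \<longleftrightarrow> P Va \<and> P Vb \<and> P Vc \<and> P Vd \<and> P Ve"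
  by (metis vertex.exhaust)

lemma bipyramid_three_coordinates:
  assumes "x \<in> bipyramid" "i \<noteq> j" "j \<noteq> k" "i \<noteq> k"
  shows "x $ i = 0 \<or> x $ j = 0 \<or> x $ k = 0"
proof -
  obtain e where e: "e \<in> bipyramid_edges" "\<forall>i. i \<notin> e \<longrightarrow> x $ i = 0"
    using assms(1) mem_bipyramid by blast
  obtain v w where "e = {v, w}"
    using card_bipyramid_edge[OF e(1)] by (auto simp: card_2_iff)
  then have "i \<notin> e \<or> j \<notin> e \<or> k \<notin> e" using assms(2-4) by auto
  then show ?thesis using e(2) by blast
qed

lemma bipyramid_apexes:
  assumes "x \<in> bipyramid"
  shows "x $ Vd = 0 \<or> x $ Ve = 0"
  using assms unfolding mem_bipyramid by (auto simp: bipyramid_edges_def)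

text \<open>On the bipyramid graph this is the function that is linear on edges with value \<open>3\<close> at the
  apexes \<open>d\<close> and \<open>e\<close> and \<open>1\<close> at the base vertices.\<close>

definition height :: "real ^ vertex \<Rightarrow> real" where
  "height x = x $ Va + x $ Vb + x $ Vc + 3 * x $ Vd + 3 * x $ Ve"

lemma linear_on_bipyramid_edges_eq_height:
  assumes "linear_on_edges bipyramid_edges f"
    and "f (vertex_point Vd) = 3" "f (vertex_point Ve) = 3"
    and "f (vertex_point Va) = 1" "f (vertex_point Vb) = 1" "f (vertex_point Vc) = 1"
    and x: "x \<in> bipyramid"
  shows "f x = height x"
proof -
  have vertices: "f (vertex_point i) = height (vertex_point i)" for i
    using assms(2-6) by (cases i) (auto simp: height_def vertex_point_nth)
  obtain e where e: "e \<in> bipyramid_edges" "\<forall>i. i \<notin> e \<longrightarrow> x $ i = 0"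
    using x mem_bipyramid by blast
  obtain v w where vw: "e = {v, w}" "v \<noteq> w"
    using card_bipyramid_edge[OF e(1)] by (auto simp: card_2_iff)
  have "(\<Sum>i\<in>UNIV. x $ i) = (\<Sum>i\<in>{v, w}. x $ i)"
    by (rule sum.mono_neutral_right) (use e vw in auto)
  then have sum: "x $ v = 1 - x $ w"
    using x vw unfolding mem_bipyramid sum_vertex by simp
  have x_eq: "x = (1 - x $ w) *\<^sub>R vertex_point v + x $ w *\<^sub>R vertex_point w"
    using e(2) vw sum by (auto simp: vec_eq_iff vertex_point_nth)
  have range: "x $ w \<in> {0..1}"
    using x sum unfolding mem_bipyramid by (metis atLeastAtMost_iff diff_ge_0_iff_ge)
  have "f x = (1 - x $ w) * f (vertex_point v) + x $ w * f (vertex_point w)"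
    using assms(1) e(1) vw(1) range x_eq unfolding linear_on_edges_def by metis
  also have "\<dots> = height ((1 - x $ w) *\<^sub>R vertex_point v + x $ w *\<^sub>R vertex_point w)"
    unfolding vertices by (simp add: height_def algebra_simps)
  finally show ?thesis using x_eq by simp
qed

section \<open>Three unimodal summands\<close>

text \<open>Drop the coordinates outside \<open>{p, d, e}\<close> and normalize: this pushes each point along its own
  edge onto the path \<open>d p e\<close>, and the function does not decrease on the way. The path then
  contracts to \<open>p\<close>. Both homotopies are straight lines, which stay in the graph because their end
  points always share an edge.\<close>

lemma contractible_superlevel_of_star:
  assumes p: "p \<in> {Va, Vb, Vc}" and c: "0 < c" "c \<le> 1"
  shows "contractible {x \<in> bipyramid. c \<le> x $ p + x $ Vd + x $ Ve}" (is "contractible ?S")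
proof -
  define w :: "real ^ vertex \<Rightarrow> real" where "w x = x $ p + x $ Vd + x $ Ve" for x
  define r :: "real ^ vertex \<Rightarrow> real ^ vertex" where
    "r x = (\<chi> i. if i \<in> {p, Vd, Ve} then x $ i / w x else 0)" for x
  have S: "x \<in> bipyramid" "c \<le> w x" "0 < w x" if "x \<in> ?S" for x
    using that c by (auto simp: w_def)
  have w_r: "w (r x) = 1" if "0 < w x" for x
    using that p by (auto simp: w_def r_def add_divide_distrib[symmetric])
  have sum_r: "(\<Sum>i\<in>UNIV. r x $ i) = 1" if "0 < w x" for x
  proof -
    have "(\<Sum>i\<in>UNIV. r x $ i) = w (r x)"
      using p by (auto simp: sum_vertex w_def r_def)
    then show ?thesis using w_r[OF that] by simp
  qed
  have nonneg_r: "\<forall>i. 0 \<le> r x $ i" if "x \<in> ?S" for x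
    using S[OF that] by (auto simp: r_def mem_bipyramid)
  have segment: "closed_segment x y \<subseteq> ?S"
    if e: "e \<in> bipyramid_edges" and xy: "x \<in> convex hull (vertex_point ` e)"
      "y \<in> convex hull (vertex_point ` e)" "c \<le> w x" "c \<le> w y" for e x y
  proof -
    let ?H = "convex hull (vertex_point ` e) \<inter> {x. c \<le> w x}"
    have "convex {x. c \<le> w x}"
    proof (rule convexI)
      fix x y :: "real ^ vertex" and s t :: real
      assume *: "x \<in> {x. c \<le> w x}" "y \<in> {x. c \<le> w x}" "0 \<le> s" "0 \<le> t" "s + t = 1"
      then have "s * c + t * c \<le> s * w x + t * w y"
        by (intro add_mono mult_left_mono) auto
      moreover have "s * c + t * c = c" using * by (metis distrib_right mult_1)
      ultimately show "s *\<^sub>R x + t *\<^sub>R y \<in> {x. c \<le> w x}"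
        by (simp add: w_def algebra_simps)
    qed
    then have "closed_segment x y \<subseteq> ?H"
      using xy by (intro closed_segment_subset convex_Int) auto
    then show ?thesis
      using convex_hull_edge_subset_bipyramid[OF e] by (auto simp: w_def)
  qed
  have cont_r: "continuous_on ?S r"
  proof -
    have "continuous_on ?S (\<lambda>x. if i \<in> {p, Vd, Ve} then x $ i / w x else 0)" for i
    proof (cases "i \<in> {p, Vd, Ve}")
      case True
      have "continuous_on ?S (\<lambda>x. x $ i / w x)"
        using S(3) unfolding w_def by (intro continuous_intros) force+
      with True show ?thesis by simp
    next
      case False
      then show ?thesis by (simp del: insert_iff)
    qed
    then show ?thesis
      unfolding r_def by (rule continuous_on_vec_lambda)
  qed
  have "homotopic_with_canon (\<lambda>x. True) ?S ?S id r"
  proof (rule homotopic_with_linear)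
    fix x assume x: "x \<in> ?S"
    obtain e where e: "e \<in> bipyramid_edges" "\<forall>i. i \<notin> e \<longrightarrow> x $ i = 0"
      using S(1)[OF x] mem_bipyramid by blast
    have "x \<in> convex hull (vertex_point ` e)"
      using e S(1)[OF x] unfolding mem_bipyramid convex_hull_vertex_points sum_vertex by auto
    moreover have "r x \<in> convex hull (vertex_point ` e)"
      using e sum_r[OF S(3)[OF x]] nonneg_r[OF x] unfolding convex_hull_vertex_points
      by (auto simp: r_def)
    ultimately show "closed_segment (id x) (r x) \<subseteq> ?S"
      using segment[OF e(1)] S[OF x] w_r c by auto
  qed (auto simp: cont_r)
  moreover have "homotopic_with_canon (\<lambda>x. True) ?S ?S r (\<lambda>x. vertex_point p)"
  proof (rule homotopic_with_linear)
    fix x assume x: "x \<in> ?S"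
    \<comment> \<open>The apex whose half of the path contains \<open>r x\<close>; either one serves for \<open>r x = p\<close>.\<close>
    define s where "s = (if x $ Ve = 0 then Vd else Ve)"
    have e: "{p, s} \<in> bipyramid_edges"
      unfolding doubleton_in_bipyramid_edges using p by (auto simp: s_def)
    have "r x \<in> convex hull (vertex_point ` {p, s})"
      using sum_r[OF S(3)[OF x]] nonneg_r[OF x] bipyramid_apexes[OF S(1)[OF x]]
      unfolding convex_hull_vertex_points by (auto simp: r_def s_def)
    moreover have "vertex_point p \<in> convex hull (vertex_point ` {p, s})"
      by (auto intro: hull_inc)
    moreover have "w (vertex_point p) = 1"
      using p by (auto simp: w_def vertex_point_nth)
    ultimately show "closed_segment (r x) (vertex_point p) \<subseteq> ?S"
      using segment[OF e] w_r[OF S(3)[OF x]] c by auto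
  qed (auto simp: cont_r)
  ultimately show ?thesis
    unfolding contractible_def using homotopic_with_trans by blast
qed

lemma unimodal_star:
  assumes p: "p \<in> {Va, Vb, Vc}"
  shows "unimodal (top_of_set bipyramid) (\<lambda>x. x $ p + x $ Vd + x $ Ve)"
  unfolding unimodal_def
proof (intro conjI)
  show "continuous_map (top_of_set bipyramid) euclideanreal (\<lambda>x. x $ p + x $ Vd + x $ Ve)"
    by (auto intro!: continuous_intros)
  show "\<forall>x\<in>topspace (top_of_set bipyramid). 0 \<le> x $ p + x $ Vd + x $ Ve"
    by (auto simp: mem_bipyramid)
  have "{x \<in> bipyramid. c \<le> x $ p + x $ Vd + x $ Ve} \<noteq> {}" if "c \<le> 1" for c
    using that p vertex_point_in_bipyramid[of p] by (auto simp: vertex_point_nth)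
  moreover have "{x \<in> bipyramid. c \<le> x $ p + x $ Vd + x $ Ve} = {}" if "1 < c" for c
    using that p unfolding mem_bipyramid all_vertex by auto
  moreover have "subtopology (top_of_set bipyramid) {x \<in> bipyramid. Q x}
    = top_of_set {x \<in> bipyramid. Q x}" for Q
    by (simp add: subtopology_subtopology Int_absorb1)
  ultimately show "\<exists>M>0. \<forall>c.
        (0 < c \<and> c \<le> M \<longrightarrow>
           {x \<in> topspace (top_of_set bipyramid). c \<le> x $ p + x $ Vd + x $ Ve} \<noteq> {} \<and>
           contractible_space (subtopology (top_of_set bipyramid)
             {x \<in> topspace (top_of_set bipyramid). c \<le> x $ p + x $ Vd + x $ Ve})) \<and>
        (M < c \<longrightarrow> {x \<in> topspace (top_of_set bipyramid). c \<le> x $ p + x $ Vd + x $ Ve} = {})"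
    using contractible_superlevel_of_star[OF p] by (intro exI[of _ 1]) simp
qed

section \<open>Two unimodal summands do not suffice\<close>

text \<open>The part of unimodality that the lower bound needs. Unlike unimodality, it is shared by the
  zero function, so a sum of fewer than two unimodal functions becomes a sum of exactly two
  quasi-unimodal ones.\<close>

definition quasi_unimodal :: "'a::real_normed_vector set \<Rightarrow> ('a \<Rightarrow> real) \<Rightarrow> bool" where
  "quasi_unimodal X u \<longleftrightarrow> continuous_on X u \<and> (\<forall>x\<in>X. 0 \<le> u x) \<and>
     (\<forall>x\<in>X. \<forall>c. 0 < c \<and> c \<le> u x \<longrightarrow> contractible {y \<in> X. c \<le> u y})"

lemma quasi_unimodal_zero: "quasi_unimodal X (\<lambda>x. 0)"
  by (auto simp: quasi_unimodal_def)

lemma unimodal_imp_quasi_unimodal: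
  assumes "unimodal (top_of_set X) u"
  shows "quasi_unimodal X u"
proof -
  obtain M where M: "\<And>c. 0 < c \<Longrightarrow> c \<le> M \<Longrightarrow>
      contractible_space (subtopology (top_of_set X) {x \<in> X. c \<le> u x})"
    "\<And>c. M < c \<Longrightarrow> {x \<in> X. c \<le> u x} = {}"
    using assms unfolding unimodal_def by auto
  have "contractible {y \<in> X. c \<le> u y}" if "x \<in> X" "0 < c" "c \<le> u x" for x c
  proof -
    have "c \<le> M" using M(2)[of c] that by force
    then show ?thesis
      using M(1)[of c] that by (simp add: subtopology_subtopology Int_absorb1)
  qed
  then show ?thesis
    using assms by (auto simp: quasi_unimodal_def unimodal_def)
qed

lemma connected_zero:
  fixes g :: "'a::topological_space \<Rightarrow> real"
  assumes "connected S" "continuous_on S g" "x \<in> S" "y \<in> S" "g x \<le> 0" "0 \<le> g y"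
  obtains z where "z \<in> S" "g z = 0"
proof -
  have "connected (g ` S)"
    using assms by (intro connected_continuous_image)
  then have "0 \<in> g ` S"
    using assms by (meson connectedD_interval imageI)
  then show thesis using that by auto
qed

text \<open>How connectedness of superlevel sets is used: a continuous \<open>g\<close> that changes sign on a
  superlevel set has a zero in that set.\<close>

lemma superlevel_crosses_zero:
  fixes g :: "'a::real_normed_vector \<Rightarrow> real"
  assumes "quasi_unimodal X u" "continuous_on X g" "0 < c"
    and "x \<in> X" "c \<le> u x" "g x \<le> 0" "y \<in> X" "c \<le> u y" "0 \<le> g y"
  obtains z where "z \<in> X" "c \<le> u z" "g z = 0"
proof -
  have "contractible {y \<in> X. c \<le> u y}"
    using assms by (auto simp: quasi_unimodal_def)
  then have "connected {y \<in> X. c \<le> u y}"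
    by (intro path_connected_imp_connected contractible_imp_path_connected)
  moreover have "continuous_on {y \<in> X. c \<le> u y} g"
    using assms(2) by (rule continuous_on_subset) auto
  ultimately show thesis
    using connected_zero[of "{y \<in> X. c \<le> u y}" g x y] assms that by auto
qed

definition height_split :: "(real ^ vertex \<Rightarrow> real) \<Rightarrow> (real ^ vertex \<Rightarrow> real) \<Rightarrow> bool" where
  "height_split u v \<longleftrightarrow> quasi_unimodal bipyramid u \<and> quasi_unimodal bipyramid v \<and>
     (\<forall>x\<in>bipyramid. u x + v x = height x)"

lemma height_split_commute: "height_split u v \<Longrightarrow> height_split v u"
  by (auto simp: height_split_def add.commute)

lemma height_split_nonneg:
  assumes "height_split u v" "x \<in> bipyramid"
  shows "0 \<le> u x" "0 \<le> v x" "u x + v x = height x"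
  using assms by (auto simp: height_split_def quasi_unimodal_def)

text \<open>Since \<open>x\<^sub>d\<close> and \<open>x\<^sub>e\<close> are never both positive, \<open>x\<^sub>d - x\<^sub>e\<close> vanishes exactly on the base triangle.
  A superlevel set reaching both sides contains a zero of it, and there \<open>u \<le> u + v = 1\<close>.\<close>

lemma not_above_one_on_both_sides:
  assumes uv: "height_split u v" and x: "x \<in> bipyramid" "0 < x $ Vd" and y: "y \<in> bipyramid" "0 < y $ Ve"
  shows "u x \<le> 1 \<or> u y \<le> 1"
proof (rule ccontr)
  define c where "c = min (u x) (u y)"
  assume "\<not> ?thesis"
  then have "1 < c" by (simp add: c_def)
  obtain z where z: "z \<in> bipyramid" "c \<le> u z" "z $ Vd - z $ Ve = 0"
  proof (rule superlevel_crosses_zero[of bipyramid u "\<lambda>z. z $ Vd - z $ Ve" c y x])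
    show "quasi_unimodal bipyramid u" using uv by (simp add: height_split_def)
    show "y \<in> bipyramid" "x \<in> bipyramid" using x y by auto
    show "y $ Vd - y $ Ve \<le> 0" "0 \<le> x $ Vd - x $ Ve"
      using bipyramid_apexes[OF x(1)] bipyramid_apexes[OF y(1)] x(2) y(2) by auto
  qed (use \<open>1 < c\<close> in \<open>auto simp: c_def intro!: continuous_intros\<close>)
  have "z $ Vd = 0" "z $ Ve = 0" using z(3) bipyramid_apexes[OF z(1)] by auto
  then have "height z = 1" using z(1) by (simp add: mem_bipyramid height_def)
  then show False
    using height_split_nonneg[OF uv z(1)] z(2) \<open>1 < c\<close> by simp
qed

text \<open>The end points \<open>p\<close> and \<open>q\<close> separate the open edge \<open>pq\<close> from the rest of the graph.\<close>

lemma base_edge_separates: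
  assumes pq: "p \<in> {Va, Vb, Vc}" "q \<in> {Va, Vb, Vc}" "p \<noteq> q" and s': "s' \<in> {Vd, Ve}"
    and u: "quasi_unimodal bipyramid u" and c: "0 < c"
    and z: "z \<in> bipyramid" "0 < z $ p" "0 < z $ q" "c \<le> u z" and us': "c \<le> u (vertex_point s')"
  shows "c \<le> u (vertex_point p) \<or> c \<le> u (vertex_point q)"
proof -
  \<comment> \<open>At most one of the two terms of \<open>?g\<close> is nonzero: the product lives on the open edge, the bracket
    off the closed edge. Hence \<open>?g\<close> is positive on the open edge, zero at \<open>p\<close> and \<open>q\<close> only, and
    negative elsewhere.\<close>
  let ?g = "\<lambda>x :: real ^ vertex. x $ p * x $ q - (1 - x $ p - x $ q)"
  have edge: "x $ p + x $ q = 1 \<and> (\<forall>i. i \<notin> {p, q} \<longrightarrow> x $ i = 0)"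
    if "x \<in> bipyramid" "x $ p \<noteq> 0" "x $ q \<noteq> 0" for x
  proof -
    have 0: "\<forall>i. i \<notin> {p, q} \<longrightarrow> x $ i = 0"
      using bipyramid_three_coordinates[OF that(1)] that pq(3) by blast
    have "(\<Sum>i\<in>UNIV. x $ i) = (\<Sum>i\<in>{p, q}. x $ i)"
      by (rule sum.mono_neutral_right) (use 0 in auto)
    with 0 show ?thesis using that(1) pq(3) by (simp add: mem_bipyramid sum_vertex)
  qed
  obtain x where x: "x \<in> bipyramid" "c \<le> u x" "?g x = 0"
  proof (rule superlevel_crosses_zero[of bipyramid u ?g c "vertex_point s'" z])
    show "?g (vertex_point s') \<le> 0"
      using pq s' by (auto simp: vertex_point_nth)
    have "z $ p + z $ q = 1" using edge[OF z(1)] z(2,3) by simp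
    moreover have "0 \<le> z $ p * z $ q" using z(2,3) by simp
    ultimately show "0 \<le> ?g z" by linarith
  qed (use u c z us' vertex_point_in_bipyramid in \<open>auto intro!: continuous_intros\<close>)
  have nonneg: "\<forall>i. 0 \<le> x $ i" using x(1) mem_bipyramid by blast
  have "x $ p = 0 \<or> x $ q = 0"
  proof (rule ccontr)
    assume "\<not> ?thesis"
    then have "x $ p + x $ q = 1" "x $ p * x $ q \<noteq> 0" using edge[OF x(1)] by auto
    then show False using x(3) by linarith
  qed
  then have "x $ p = 1 \<or> x $ q = 1"
    using x(3) by auto
  then obtain i where i: "i \<in> {p, q}" "x $ i = 1"
    by blast
  have "(\<Sum>j\<in>UNIV. x $ j) = x $ i + (\<Sum>j\<in>UNIV - {i}. x $ j)"
    by (simp add: sum.remove)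
  then have "(\<Sum>j\<in>UNIV - {i}. x $ j) = 0"
    using x(1) i(2) by (simp add: mem_bipyramid sum_vertex)
  then have "\<forall>j\<in>UNIV - {i}. x $ j = 0"
    using nonneg by (subst (asm) sum_nonneg_eq_0_iff) auto
  then have "x = vertex_point i"
    using i(2) by (auto simp: vec_eq_iff vertex_point_nth)
  then show ?thesis using x(2) i(1) by auto
qed

text \<open>If \<open>u\<close> were positive at both \<open>p\<close> and \<open>q\<close>, it would be positive on the entire triangle \<open>pqs\<close>:
  a zero on the sides at \<open>s\<close> would put \<open>v\<close> above \<open>1\<close> on both sides of the base, and a zero inside
  the side \<open>pq\<close> is excluded by \<open>base_edge_separates\<close>.\<close>

lemma positive_at_one_base_vertex:
  assumes uv: "height_split u v"
    and s: "s = Vd \<and> s' = Ve \<or> s = Ve \<and> s' = Vd" and vs': "1 < v (vertex_point s')"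
    and pq: "p \<in> {Va, Vb, Vc}" "q \<in> {Va, Vb, Vc}" "p \<noteq> q"
  shows "u (vertex_point p) = 0 \<or> u (vertex_point q) = 0"
proof (rule ccontr)
  assume "\<not> ?thesis"
  then have pos: "0 < u (vertex_point p)" "0 < u (vertex_point q)"
    using height_split_nonneg(1)[OF uv vertex_point_in_bipyramid, of p]
      height_split_nonneg(1)[OF uv vertex_point_in_bipyramid, of q] by auto
  have neq: "p \<noteq> q" "q \<noteq> s" "s \<noteq> p" using pq s by auto
  have qv: "quasi_unimodal bipyramid v" and qu: "quasi_unimodal bipyramid u"
    using uv by (auto simp: height_split_def)
  define T where "T = (\<Union>i\<in>{p, q, s}. convex hull (vertex_point ` ({p, q, s} - {i})))"
  have sides: "{p, q, s} - {i} \<in> bipyramid_edges" if "i \<in> {p, q, s}" for i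
  proof -
    have "{p, s} \<in> bipyramid_edges" "{q, s} \<in> bipyramid_edges" "{p, q} \<in> bipyramid_edges"
      unfolding doubleton_in_bipyramid_edges using pq neq by blast+
    moreover have "{p, q, s} - {p} = {q, s}" "{p, q, s} - {q} = {p, s}" "{p, q, s} - {s} = {p, q}"
      using neq by auto
    ultimately show ?thesis using that by (elim insertE) simp_all
  qed
  then have T_sub: "T \<subseteq> bipyramid"
    unfolding T_def using convex_hull_edge_subset_bipyramid by blast
  have u_pos: "0 < u z" if "z \<in> T" for z
  proof (rule ccontr)
    assume "\<not> 0 < u z"
    moreover have z: "z \<in> bipyramid" using T_sub that by auto
    ultimately have "u z = 0" and vz: "v z = height z"
      using height_split_nonneg[OF uv z] by auto
    have supp: "\<forall>i. i \<notin> {p, q, s} \<longrightarrow> z $ i = 0"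
      using that unfolding T_def convex_hull_vertex_points by auto
    have "(\<Sum>i\<in>UNIV. z $ i) = (\<Sum>i\<in>{p, q, s}. z $ i)"
      by (rule sum.mono_neutral_right) (use supp in auto)
    then have sum: "z $ p + z $ q + z $ s = 1"
      using z neq by (simp add: mem_bipyramid sum_vertex)
    have nonneg: "0 \<le> z $ i" for i using z mem_bipyramid by blast
    have hz: "height z = 1 + 2 * z $ s"
      using z s supp pq by (auto simp: height_def mem_bipyramid)
    show False
    proof (cases "z $ s = 0")
      case False
      then have "1 < v z" "0 < z $ s" using vz hz nonneg[of s] by auto
      then show False
        using s vs' z vertex_point_in_bipyramid[of s']
          not_above_one_on_both_sides[OF height_split_commute[OF uv], of z "vertex_point s'"]
          not_above_one_on_both_sides[OF height_split_commute[OF uv], of "vertex_point s'" z]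
        by (auto simp: vertex_point_nth)
    next
      case True
      have "z $ p \<noteq> 0"
      proof
        assume "z $ p = 0"
        then have "z = vertex_point q"
          using True sum supp by (auto simp: vec_eq_iff vertex_point_nth)
        then show False using pos \<open>u z = 0\<close> by simp
      qed
      moreover have "z $ q \<noteq> 0"
      proof
        assume "z $ q = 0"
        then have "z = vertex_point p"
          using True sum supp by (auto simp: vec_eq_iff vertex_point_nth)
        then show False using pos \<open>u z = 0\<close> by simp
      qed
      ultimately have "1 \<le> v (vertex_point p) \<or> 1 \<le> v (vertex_point q)"
        using base_edge_separates[OF pq, of s' v 1 z] qv z nonneg[of p] nonneg[of q]
          s vz hz True vs' by auto
      moreover have "u (vertex_point i) + v (vertex_point i) = 1" if "i \<in> {p, q}" for i
        using height_split_nonneg(3)[OF uv vertex_point_in_bipyramid, of i] that pq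
        by (auto simp: height_def vertex_point_nth)
      ultimately show False using pos by force
    qed
  qed
  \<comment> \<open>The minimum of \<open>u\<close> on the triangle is a positive level whose superlevel set contains it.\<close>
  have "compact T"
    unfolding T_def by (intro compact_UN finite_imp_compact_convex_hull) auto
  moreover have "vertex_point p \<in> T"
    unfolding T_def using neq by (auto intro!: hull_inc)
  moreover have "continuous_on T u"
    using qu T_sub continuous_on_subset by (auto simp: quasi_unimodal_def)
  ultimately obtain m where m: "m \<in> T" "\<forall>x\<in>T. u m \<le> u x"
    using continuous_attains_inf[of T u] by auto
  have "contractible {x \<in> bipyramid. u m \<le> u x}"
    using qu u_pos[OF m(1)] m(1) T_sub by (auto simp: quasi_unimodal_def)
  then show False
    using contractible_subset_of_graph_no_triangle[OF card_bipyramid_edge bipyramid_vertices_covered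
        _ _ neq, of "{x \<in> bipyramid. u m \<le> u x}"] m(2) T_sub
    unfolding T_def by blast
qed

text \<open>Two of the three base vertices have to be served by the same summand, which contradicts
  \<open>positive_at_one_base_vertex\<close> for that summand and the apex at which it exceeds \<open>1\<close>.\<close>

lemma no_height_split: "\<not> height_split u v"
proof
  assume uv: "height_split u v"
  note vu = height_split_commute[OF uv]
  have sums: "u (vertex_point i) + v (vertex_point i) = height (vertex_point i)" for i
    using height_split_nonneg(3)[OF uv vertex_point_in_bipyramid] .
  have apex_sums: "u (vertex_point Vd) + v (vertex_point Vd) = 3"
    "u (vertex_point Ve) + v (vertex_point Ve) = 3"
    using sums[of Vd] sums[of Ve] by (auto simp: height_def vertex_point_nth)
  have base_sums: "u (vertex_point i) + v (vertex_point i) = 1" if "i \<in> {Va, Vb, Vc}" for i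
    using sums[of i] that by (auto simp: height_def vertex_point_nth)
  have "u (vertex_point Vd) \<le> 1 \<or> u (vertex_point Ve) \<le> 1"
    "v (vertex_point Vd) \<le> 1 \<or> v (vertex_point Ve) \<le> 1"
    using not_above_one_on_both_sides[OF uv] not_above_one_on_both_sides[OF vu]
      vertex_point_in_bipyramid by (auto simp: vertex_point_nth)
  then obtain s s' where s: "s = Vd \<and> s' = Ve \<or> s = Ve \<and> s' = Vd"
    and us: "1 < u (vertex_point s)" and vs': "1 < v (vertex_point s')"
    using apex_sums by (smt (verit))
  have s_swap: "s' = Vd \<and> s = Ve \<or> s' = Ve \<and> s = Vd" using s by auto
  note u_zero = positive_at_one_base_vertex[OF uv s vs']
  note v_zero = positive_at_one_base_vertex[OF vu s_swap us]
  show False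
    using u_zero[of Va Vb] u_zero[of Vb Vc] u_zero[of Va Vc]
      v_zero[of Va Vb] v_zero[of Vb Vc] v_zero[of Va Vc]
      base_sums[of Va] base_sums[of Vb] base_sums[of Vc] by auto
qed

theorem proposition4p10:
  fixes f :: "real ^ vertex \<Rightarrow> real"
  assumes "linear_on_edges bipyramid_edges f"
    and "f (vertex_point Vd) = 3" and "f (vertex_point Ve) = 3"
    and "f (vertex_point Va) = 1" and "f (vertex_point Vb) = 1" and "f (vertex_point Vc) = 1"
  shows "ucat (top_of_set (graph_realization bipyramid_vertices bipyramid_edges)) f = 3"
proof -
  note f = linear_on_bipyramid_edges_eq_height[OF assms]
  let ?N = "{enat n | n. \<exists>u :: nat \<Rightarrow> real ^ vertex \<Rightarrow> real.
      (\<forall>i<n. unimodal (top_of_set bipyramid) (u i)) \<and>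
      (\<forall>x\<in>topspace (top_of_set bipyramid). f x = (\<Sum>i<n. u i x))}"
  have "enat 3 \<in> ?N"
  proof (intro CollectI exI conjI)
    let ?u = "\<lambda>i (x :: real ^ vertex). x $ ([Va, Vb, Vc] ! i) + x $ Vd + x $ Ve"
    show "\<forall>i<3. unimodal (top_of_set bipyramid) (?u i)"
      by (intro allI impI unimodal_star) (auto simp: less_Suc_eq numeral_3_eq_3)
    show "\<forall>x\<in>topspace (top_of_set bipyramid). f x = (\<Sum>i<3. ?u i x)"
      by (auto simp: f height_def numeral_3_eq_3)
  qed simp
  moreover have "enat 3 \<le> N" if "N \<in> ?N" for N
  proof -
    obtain n u where n: "N = enat n"
      and u: "\<And>i. i < n \<Longrightarrow> unimodal (top_of_set bipyramid) (u i)"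
        "\<And>x. x \<in> bipyramid \<Longrightarrow> f x = (\<Sum>i<n. u i x)"
      using \<open>N \<in> ?N\<close> by auto
    have False if "n < 3"
    proof -
      \<comment> \<open>Pad with zero functions so that all \<open>n < 3\<close> are cases of two summands.\<close>
      define g where "g i = (if i < n then u i else (\<lambda>x. 0))" for i
      have "quasi_unimodal bipyramid (g i)" for i
        using u(1)[of i] by (auto simp: g_def unimodal_imp_quasi_unimodal quasi_unimodal_zero)
      moreover have "g 0 x + g 1 x = height x" if "x \<in> bipyramid" for x
      proof -
        have "n \<in> {0, 1, 2}" using \<open>n < 3\<close> by auto
        then show ?thesis
          using u(2)[OF that] f[OF that] by (auto simp: g_def numeral_2_eq_2)
      qed
      ultimately have "height_split (g 0) (g 1)"
        by (simp add: height_split_def)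
      then show False using no_height_split by blast
    qed
    then show ?thesis using n by force
  qed
  ultimately have "Inf ?N = enat 3"
    by (intro antisym Inf_lower Inf_greatest)
  then show ?thesis
    by (simp add: ucat_def numeral_eq_enat)
qed

end
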